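(* Let $\mathscr{F}\subseteq\mathscr{P}(\omega)$ be a nonempty $\omega$-closed family and let $(i,i,F_i)$ and $(j,j,F_j)$ be non-zero idempotents of $\boldsymbol{B}_{\omega}^{\mathscr{F}}$ (where $i,j\in\omega$ and $F_i,F_j\in\mathscr{F}$ are nonempty). Then $(i,i,F_i)\preccurlyeq(j,j,F_j)$ in $E(\boldsymbol{B}_{\omega}^{\mathscr{F}})$ if and only if $i\geqslant j$ and $F_i\subseteq j-i+F_j$.
   Context: $\omega$ is the set of non-negative integers, $\mathscr{P}(\omega)$ its power set. For an integer $n$ and $F\subseteq\omega$ put $n+F=\{n+k\colon k\in F\}\subseteq\mathbb{Z}$ (empty if $F=\varnothing$). A family $\mathscr{F}\subseteq\mathscr{P}(\omega)$ is $\omega$-closed if $F_1\cap(-n+F_2)\in\mathscr{F}$ for all $n\in\omega$ and $F_1,F_2\in\mathscr{F}$. For an $\omega$-closed family $\mathscr{F}$, the set $\boldsymbol{B}_{\omega}\times\mathscr{F}=\omega\times\omega\times\mathscr{F}$ carries the semigroup operation $$(i_1,j_1,F_1)\cdot(i_2,j_2,F_2)=\begin{cases}(i_1-j_1+i_2,\,j_2,\,(j_1-i_2+F_1)\cap F_2), & j_1\leqslant i_2;\\ (i_1,\,j_1-i_2+j_2,\,F_1\cap(i_2-j_1+F_2)), & j_1\geqslant i_2.\end{cases}$$ If $\varnothing\notin\mathscr{F}$, then $\boldsymbol{B}_{\omega}^{\mathscr{F}}=(\boldsymbol{B}_{\omega}\times\mathscr{F},\cdot)$. If $\varnothing\in\mathscr{F}$,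 then $\boldsymbol{I}=\{(i,j,\varnothing)\colon i,j\in\omega\}$ is an ideal and $\boldsymbol{B}_{\omega}^{\mathscr{F}}$ is the Rees quotient $(\boldsymbol{B}_{\omega}\times\mathscr{F},\cdot)/\boldsymbol{I}$, in which all $(i,j,\varnothing)$ are identified to a single zero element $\boldsymbol{0}$. $E(S)$ denotes the set of idempotents of a semigroup $S$, with natural partial order $e\preccurlyeq f$ if and only if $ef=fe=e$. Every element $(i,i,F)$ is an idempotent of $\boldsymbol{B}_{\omega}^{\mathscr{F}}$. *)

theory Defs
  imports Main
begin

text \<open>A semigroup is given by a carrier and a multiplication, which is only meaningful on the
  carrier. The HOL-Algebra structures are not used because they require an identity element, which
  the semigroups below need not have.\<close>

record 'a sgrp =
  elems :: "'a set"
  times :: "'a \<Rightarrow> 'a \<Rightarrow> 'a"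

definition semigroup_on :: "'a sgrp \<Rightarrow> bool" where
  "semigroup_on S \<longleftrightarrow>
     (\<forall>x\<in>elems S. \<forall>y\<in>elems S. times S x y \<in> elems S) \<and>
     (\<forall>x\<in>elems S. \<forall>y\<in>elems S. \<forall>z\<in>elems S.
        times S (times S x y) z = times S x (times S y z))"

definition idempotents :: "'a sgrp \<Rightarrow> 'a set" where
  "idempotents S = {e \<in> elems S. times S e e = e}"

definition idem_le :: "'a sgrp \<Rightarrow> 'a \<Rightarrow> 'a \<Rightarrow> bool" where
  "idem_le S e f \<longleftrightarrow>
     e \<in> idempotents S \<and> f \<in> idempotents S \<and> times S e f = e \<and> times S f e = e"

definition is_ideal :: "'a sgrp \<Rightarrow> 'a set \<Rightarrow> bool" where
  "is_ideal S I \<longleftrightarrow>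
     I \<subseteq> elems S \<and> (\<forall>x\<in>I. \<forall>s\<in>elems S. times S x s \<in> I \<and> times S s x \<in> I)"

definition rees_cong :: "'a sgrp \<Rightarrow> 'a set \<Rightarrow> ('a \<times> 'a) set" where
  "rees_cong S I = {(x, y). x \<in> elems S \<and> y \<in> elems S \<and> (x = y \<or> x \<in> I \<and> y \<in> I)}"

definition rees_class :: "'a sgrp \<Rightarrow> 'a set \<Rightarrow> 'a \<Rightarrow> 'a set" where
  "rees_class S I x = rees_cong S I `` {x}"

text \<open>The Rees quotient consists of the classes of the Rees congruence, multiplied through
  representatives. For \<open>I = {}\<close> it is the copy of \<open>S\<close> that consists of the singletons \<open>{x}\<close>.\<close>

definition rees_quotient :: "'a sgrp \<Rightarrow> 'a set \<Rightarrow> 'a set sgrp" where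
  "rees_quotient S I =
     \<lparr>elems = elems S // rees_cong S I,
      times = (\<lambda>X Y. \<Union>x\<in>X. \<Union>y\<in>Y. rees_class S I (times S x y))\<rparr>"

text \<open>The translate \<open>n + F\<close>, a set of integers. Its intersection with a set of natural numbers is
  formed with the preimage under \<^const>\<open>int\<close>.\<close>

definition shift :: "int \<Rightarrow> nat set \<Rightarrow> int set" where
  "shift n F = (\<lambda>k. n + int k) ` F"

definition omega_closed :: "nat set set \<Rightarrow> bool" where
  "omega_closed \<F> \<longleftrightarrow> (\<forall>n. \<forall>F1\<in>\<F>. \<forall>F2\<in>\<F>. F1 \<inter> int -` shift (- int n) F2 \<in> \<F>)"

text \<open>The first two components are written so that the truncated subtraction on \<^typ>\<open>nat\<close> is
  exact. For \<open>j1 = i2\<close> both branches agree.\<close>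

fun bic_mult ::
  "nat \<times> nat \<times> nat set \<Rightarrow> nat \<times> nat \<times> nat set \<Rightarrow> nat \<times> nat \<times> nat set"
where
  "bic_mult (i1, j1, F1) (i2, j2, F2) =
     (if j1 \<le> i2
      then (i1 + (i2 - j1), j2, int -` shift (int j1 - int i2) F1 \<inter> F2)
      else (i1, (j1 - i2) + j2, F1 \<inter> int -` shift (int i2 - int j1) F2))"

definition bic_times_family :: "nat set set \<Rightarrow> (nat \<times> nat \<times> nat set) sgrp" where
  "bic_times_family \<F> = \<lparr>elems = UNIV \<times> UNIV \<times> \<F>, times = bic_mult\<rparr>"

definition empty_ideal :: "nat set set \<Rightarrow> (nat \<times> nat \<times> nat set) set" where
  "empty_ideal \<F> = {(i, j, F). F \<in> \<F> \<and> F = {}}"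

text \<open>One definition covers both cases: if \<open>{} \<notin> \<F>\<close>, then \<^term>\<open>empty_ideal \<F>\<close> is empty, and the
  quotient is the semigroup \<^term>\<open>bic_times_family \<F>\<close> itself, up to the identification of
  \<open>x\<close> with \<open>{x}\<close> (lemma \<open>B_fam_no_empty\<close>).\<close>

definition B_fam :: "nat set set \<Rightarrow> (nat \<times> nat \<times> nat set) set sgrp" where
  "B_fam \<F> = rees_quotient (bic_times_family \<F>) (empty_ideal \<F>)"

definition B_elem :: "nat set set \<Rightarrow> nat \<Rightarrow> nat \<Rightarrow> nat set \<Rightarrow> (nat \<times> nat \<times> nat set) set" where
  "B_elem \<F> i j F = rees_class (bic_times_family \<F>) (empty_ideal \<F>) (i, j, F)"

lemma vimage_shift: "int -` shift (- int d) F = {k. k + d \<in> F}"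
proof -
  have "int k \<in> shift (- int d) F \<longleftrightarrow> k + d \<in> F" for k
  proof -
    have "int k = - int d + int m \<longleftrightarrow> m = k + d" for m by linarith
    then show ?thesis by (simp only: shift_def image_iff) simp
  qed
  then show ?thesis by auto
qed

lemma bic_mult_le: "bic_mult (i1, j1, F1) (j1 + d, j2, F2) = (i1 + d, j2, {k\<in>F2. k + d \<in> F1})"
  using vimage_shift[of d F1] by auto

lemma bic_mult_ge: "bic_mult (i1, i2 + d, F1) (i2, j2, F2) = (i1, d + j2, {k\<in>F1. k + d \<in> F2})"
  using vimage_shift[of d F2] vimage_shift[of 0 F1] by auto

lemma omega_closed_iff:
  "omega_closed \<F> \<longleftrightarrow> (\<forall>n. \<forall>F1\<in>\<F>. \<forall>F2\<in>\<F>. {k\<in>F1. k + n \<in> F2} \<in> \<F>)"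
  by (simp add: omega_closed_def vimage_shift Int_def)

lemma bic_mult_assoc: "bic_mult (bic_mult x y) z = bic_mult x (bic_mult y z)"
proof -
  obtain i1 j1 F1 i2 j2 F2 i3 j3 F3
    where xyz: "x = (i1, j1, F1)" "y = (i2, j2, F2)" "z = (i3, j3, F3)"
    by (metis prod_cases3)
  consider (a) d e where "i2 = j1 + d" "i3 = j2 + e"
    | (b) d e where "i2 = j1 + d" "j2 = i3 + e"
    | (c) d e where "j1 = i2 + d" "j2 = i3 + e"
    | (d) d e where "j1 = i2 + d" "i3 = j2 + (d + e)"
    | (f) d e where "j1 = i2 + (e + d)" "i3 = j2 + e"
  proof -
    consider "j1 \<le> i2" "j2 \<le> i3" | "j1 \<le> i2" "i3 \<le> j2" | "i2 \<le> j1" "i3 \<le> j2"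
      | "i2 \<le> j1" "j2 + (j1 - i2) \<le> i3" | "i2 \<le> j1" "j2 \<le> i3" "i3 \<le> j2 + (j1 - i2)"
      by linarith
    then show ?thesis
    proof cases
      case 1 then show ?thesis using a[of "i2 - j1" "i3 - j2"] by simp
    next
      case 2 then show ?thesis using b[of "i2 - j1" "j2 - i3"] by simp
    next
      case 3 then show ?thesis using c[of "j1 - i2" "j2 - i3"] by simp
    next
      case 4 then show ?thesis using d[of "j1 - i2" "i3 - (j2 + (j1 - i2))"] by simp
    next
      case 5 then show ?thesis using f[of "i3 - j2" "(j1 - i2) - (i3 - j2)"] by simp
    qed
  qed
  then show ?thesis
  proof cases
    case a
    have "bic_mult (bic_mult x y) z
        = (i1 + d + e, j3, {k\<in>F3. k + e \<in> {k\<in>F2. k + d \<in> F1}})"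
      unfolding xyz a bic_mult_le ..
    moreover have "bic_mult x (bic_mult y z)
        = (i1 + (d + e), j3, {k\<in>{k\<in>F3. k + e \<in> F2}. k + (d + e) \<in> F1})"
      unfolding xyz a bic_mult_le add.assoc[of j1] ..
    ultimately show ?thesis by (auto simp: ac_simps)
  next
    case b
    have "bic_mult (bic_mult x y) z
        = (i1 + d, e + j3, {k\<in>{k\<in>F2. k + d \<in> F1}. k + e \<in> F3})"
      unfolding xyz b bic_mult_le bic_mult_ge ..
    moreover have "bic_mult x (bic_mult y z)
        = (i1 + d, e + j3, {k\<in>{k\<in>F2. k + e \<in> F3}. k + d \<in> F1})"
      unfolding xyz b bic_mult_le bic_mult_ge ..
    ultimately show ?thesis by auto
  next
    case c
    have "bic_mult (bic_mult x y) z
        = (i1, (d + e) + j3, {k\<in>{k\<in>F1. k + d \<in> F2}. k + (d + e) \<in> F3})"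
      unfolding xyz c bic_mult_ge using bic_mult_ge[of i1 i3 "d + e"] by (simp only: ac_simps)
    moreover have "bic_mult x (bic_mult y z)
        = (i1, d + (e + j3), {k\<in>F1. k + d \<in> {k\<in>F2. k + e \<in> F3}})"
      unfolding xyz c bic_mult_ge ..
    ultimately show ?thesis by (auto simp: ac_simps)
  next
    case d
    have "bic_mult (bic_mult x y) z
        = (i1 + e, j3, {k\<in>F3. k + e \<in> {k\<in>F1. k + d \<in> F2}})"
      unfolding xyz d bic_mult_ge using bic_mult_le[of i1 "d + j2" _ e] by (simp only: ac_simps)
    moreover have "bic_mult x (bic_mult y z)
        = (i1 + e, j3, {k\<in>{k\<in>F3. k + (d + e) \<in> F2}. k + e \<in> F1})"
      unfolding xyz d bic_mult_le using bic_mult_le[of i1 "i2 + d" _ e] by (simp only: ac_simps)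
    ultimately show ?thesis by (auto simp: ac_simps)
  next
    case f
    have "bic_mult (bic_mult x y) z
        = (i1, d + j3, {k\<in>{k\<in>F1. k + (e + d) \<in> F2}. k + d \<in> F3})"
      unfolding xyz f bic_mult_ge using bic_mult_ge[of i1 "j2 + e" d] by (simp only: ac_simps)
    moreover have "bic_mult x (bic_mult y z)
        = (i1, d + j3, {k\<in>F1. k + d \<in> {k\<in>F3. k + e \<in> F2}})"
      unfolding xyz f bic_mult_le using bic_mult_ge[of i1 "i2 + e" d] by (simp only: ac_simps)
    ultimately show ?thesis by (auto simp: ac_simps)
  qed
qed

lemma bic_mult_cases:
  obtains (le) d where "i2 = j1 + d"
      "bic_mult (i1, j1, F1) (i2, j2, F2) = (i1 + d, j2, {k\<in>F2. k + d \<in> F1})"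
    | (ge) d where "j1 = i2 + d"
      "bic_mult (i1, j1, F1) (i2, j2, F2) = (i1, d + j2, {k\<in>F1. k + d \<in> F2})"
proof (cases "j1 \<le> i2")
  case True
  then obtain d where d: "i2 = j1 + d" using le_Suc_ex by blast
  show ?thesis by (rule le[of d]) (simp_all only: d bic_mult_le)
next
  case False
  then obtain d where d: "j1 = i2 + d" using le_Suc_ex nat_le_linear by blast
  show ?thesis by (rule ge[of d]) (simp_all only: d bic_mult_ge)
qed

lemma semigroup_bic_times_family:
  assumes "omega_closed \<F>"
  shows "semigroup_on (bic_times_family \<F>)"
proof -
  have "bic_mult (i1, j1, F1) (i2, j2, F2) \<in> UNIV \<times> UNIV \<times> \<F>"
    if "F1 \<in> \<F>" "F2 \<in> \<F>" for i1 j1 F1 i2 j2 F2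
    using assms that
    by (cases rule: bic_mult_cases[of i2 j1 i1 F1 j2 F2]) (auto simp: omega_closed_iff simp del: bic_mult.simps)
  then show ?thesis
    by (auto simp: semigroup_on_def bic_times_family_def bic_mult_assoc simp del: bic_mult.simps)
qed

lemma is_ideal_empty_ideal: "is_ideal (bic_times_family \<F>) (empty_ideal \<F>)"
proof -
  have zero: "x \<in> empty_ideal \<F> \<longleftrightarrow> {} \<in> \<F> \<and> snd (snd x) = {}" for x
    by (cases x) (auto simp: empty_ideal_def)
  have mult: "snd (snd (bic_mult x y)) = {}" if "snd (snd x) = {} \<or> snd (snd y) = {}" for x y
  proof -
    obtain i1 j1 F1 i2 j2 F2 where xy: "x = (i1, j1, F1)" "y = (i2, j2, F2)"
      by (metis prod_cases3)
    show ?thesis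
      by (cases rule: bic_mult_cases[of i2 j1 i1 F1 j2 F2])
        (use that in \<open>auto simp: xy simp del: bic_mult.simps\<close>)
  qed
  have "empty_ideal \<F> \<subseteq> elems (bic_times_family \<F>)"
    by (auto simp: empty_ideal_def bic_times_family_def)
  moreover have "bic_mult x s \<in> empty_ideal \<F> \<and> bic_mult s x \<in> empty_ideal \<F>"
    if "x \<in> empty_ideal \<F>" for x s
    using that mult unfolding zero by blast
  ultimately show ?thesis
    unfolding is_ideal_def by (simp add: bic_times_family_def)
qed

lemma equiv_rees_cong: "equiv (elems S) (rees_cong S I)"
  by (auto simp: equiv_def refl_on_def sym_def trans_def rees_cong_def)

lemma rees_class_eqI: "(x, y) \<in> rees_cong S I \<Longrightarrow> rees_class S I x = rees_class S I y"
  unfolding rees_class_def by (rule equiv_class_eq[OF equiv_rees_cong])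

lemma rees_quotient_times:
  assumes S: "semigroup_on S" and I: "is_ideal S I" and x: "x \<in> elems S" and y: "y \<in> elems S"
  shows "times (rees_quotient S I) (rees_class S I x) (rees_class S I y)
         = rees_class S I (times S x y)"
proof -
  have *: "rees_class S I (times S a b) = rees_class S I (times S x y)"
    if "a \<in> rees_class S I x" "b \<in> rees_class S I y" for a b
  proof (rule rees_class_eqI)
    have ab: "a \<in> elems S" "b \<in> elems S" "a = x \<or> x \<in> I \<and> a \<in> I" "b = y \<or> y \<in> I \<and> b \<in> I"
      using that by (auto simp: rees_class_def rees_cong_def)
    have "times S a b \<in> elems S" "times S x y \<in> elems S"
      using S x y ab by (auto simp: semigroup_on_def)
    moreover have "times S a b = times S x y \<or> times S a b \<in> I \<and> times S x y \<in> I"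
      using I x y ab unfolding is_ideal_def by blast
    ultimately show "(times S a b, times S x y) \<in> rees_cong S I"
      by (simp add: rees_cong_def)
  qed
  have "x \<in> rees_class S I x" "y \<in> rees_class S I y"
    using x y by (simp_all add: rees_class_def rees_cong_def)
  with * have "(\<Union>a\<in>rees_class S I x. \<Union>b\<in>rees_class S I y. rees_class S I (times S a b))
      = rees_class S I (times S x y)"
    by blast
  then show ?thesis by (simp add: rees_quotient_def)
qed

lemma B_fam_no_empty:
  assumes "{} \<notin> \<F>"
  shows "bij_betw (\<lambda>x. {x}) (elems (bic_times_family \<F>)) (elems (B_fam \<F>))"
    and "omega_closed \<F> \<Longrightarrow> x \<in> elems (bic_times_family \<F>) \<Longrightarrow> y \<in> elems (bic_times_family \<F>) \<Longrightarrow>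
         times (B_fam \<F>) {x} {y} = {times (bic_times_family \<F>) x y}"
    and "F \<in> \<F> \<Longrightarrow> B_elem \<F> i j F = {(i, j, F)}"
proof -
  have I: "empty_ideal \<F> = {}" using assms by (auto simp: empty_ideal_def)
  have cls: "rees_class (bic_times_family \<F>) {} x = {x}" if "x \<in> elems (bic_times_family \<F>)" for x
    using that by (auto simp: rees_class_def rees_cong_def)
  have "elems (B_fam \<F>) = (\<lambda>x. {x}) ` elems (bic_times_family \<F>)"
    using cls unfolding rees_class_def by (simp add: B_fam_def I rees_quotient_def quotient_def) blast
  then show "bij_betw (\<lambda>x. {x}) (elems (bic_times_family \<F>)) (elems (B_fam \<F>))"
    by (simp add: bij_betw_def)
  show "times (B_fam \<F>) {x} {y} = {times (bic_times_family \<F>) x y}"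
    if "omega_closed \<F>" "x \<in> elems (bic_times_family \<F>)" "y \<in> elems (bic_times_family \<F>)"
  proof -
    have "times (bic_times_family \<F>) x y \<in> elems (bic_times_family \<F>)"
      using that semigroup_bic_times_family[of \<F>] unfolding semigroup_on_def by blast
    then show ?thesis by (simp add: B_fam_def I rees_quotient_def cls)
  qed
  show "B_elem \<F> i j F = {(i, j, F)}" if "F \<in> \<F>"
    using that cls[of "(i, j, F)"] by (simp add: B_elem_def I bic_times_family_def)
qed

end

theory Submission imports Defs begin

text \<open>The idempotents \<open>(i, i, F)\<close> already commute in \<^term>\<open>bic_times_family \<F>\<close>: for
  \<open>i = j + d\<close> the product of \<open>(i, i, F)\<close> and \<open>(j, j, G)\<close>, in either order, is
  \<open>(i, i, {k \<in> F. k + d \<in> G})\<close>. Hence \<open>(i, i, F)\<close> lies below \<open>(j, j, G)\<close> there exactly if this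
  product keeps the first factor unchanged (\<open>bic_mult_diag_absorb_iff\<close>); the index forces
  \<open>j \<le> i\<close>, and the set component says that \<open>F\<close> is contained in \<open>j - i + G\<close>.

  The Rees quotient does not disturb this. The projection is a homomorphism, and it is injective
  at elements outside the ideal, so an equation \<open>e * f = e\<close> with \<open>e\<close> nonzero holds in the quotient
  if and only if it holds for the representatives (\<open>rees_class_eq_iff\<close>, \<open>B_times_eq_iff\<close>). The
  product \<open>e * f\<close> itself may well lie in the ideal, but then it differs from \<open>e\<close> on both levels.\<close>

text \<open>The class of an element outside the ideal is a singleton, so no other element of the
  semigroup, inside the ideal or not, can share it.\<close>

lemma rees_class_eq_iff:
  assumes "x \<in> elems S" and "y \<in> elems S" and "y \<notin> I"
  shows "rees_class S I x = rees_class S I y \<longleftrightarrow> x = y"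
  using assms by (auto simp: rees_class_def rees_cong_def)

lemma B_times_eq_iff:
  assumes "omega_closed \<F>" and "F \<in> \<F>" and "G \<in> \<F>" and "H \<in> \<F>" and "H \<noteq> {}"
  shows "times (B_fam \<F>) (B_elem \<F> i j F) (B_elem \<F> k l G) = B_elem \<F> m n H
         \<longleftrightarrow> bic_mult (i, j, F) (k, l, G) = (m, n, H)"
proof -
  let ?S = "bic_times_family \<F>" and ?I = "empty_ideal \<F>"
  have S: "semigroup_on ?S"
    by (rule semigroup_bic_times_family[OF assms(1)])
  have el: "(i, j, F) \<in> elems ?S" "(k, l, G) \<in> elems ?S" "(m, n, H) \<in> elems ?S"
    using assms by (simp_all add: bic_times_family_def)
  have prod: "times ?S (i, j, F) (k, l, G) \<in> elems ?S"
    using S el unfolding semigroup_on_def by blast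
  have "(m, n, H) \<notin> ?I"
    using assms by (simp add: empty_ideal_def)
  then have "rees_class ?S ?I (times ?S (i, j, F) (k, l, G)) = rees_class ?S ?I (m, n, H)
      \<longleftrightarrow> times ?S (i, j, F) (k, l, G) = (m, n, H)"
    by (rule rees_class_eq_iff[OF prod el(3)])
  then show ?thesis
    unfolding B_fam_def B_elem_def rees_quotient_times[OF S is_ideal_empty_ideal el(1,2)]
    by (simp add: bic_times_family_def del: bic_mult.simps)
qed

lemma B_elem_in_elems: "F \<in> \<F> \<Longrightarrow> B_elem \<F> i j F \<in> elems (B_fam \<F>)"
  by (simp add: B_fam_def B_elem_def rees_class_def rees_quotient_def bic_times_family_def quotientI)

lemma bic_mult_diag_commute:
  "bic_mult (j, j, G) (i, i, F) = bic_mult (i, i, F) (j, j, G)"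
proof -
  have *: "bic_mult (j, j, G) (j + d, j + d, F) = bic_mult (j + d, j + d, F) (j, j, G)"
    for j d :: nat and F G
    unfolding bic_mult_le bic_mult_ge by (simp add: add.commute)
  show ?thesis
    using *[of j G "i - j" F] *[of i F "j - i" G] by (cases "j \<le> i") (simp_all del: bic_mult.simps)
qed

lemma int_image_subset_shift_iff:
  "int ` F \<subseteq> shift (- int d) G \<longleftrightarrow> (\<forall>k\<in>F. k + d \<in> G)"
  by (auto simp: image_subset_iff_subset_vimage vimage_shift)

lemma bic_mult_diag_absorb_iff:
  "bic_mult (i, i, F) (j, j, G) = (i, i, F) \<longleftrightarrow> j \<le> i \<and> int ` F \<subseteq> shift (int j - int i) G"
proof (cases "j \<le> i")
  case True
  then obtain d where d: "i = j + d"
    using le_Suc_ex by blast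
  then have "int ` F \<subseteq> shift (int j - int i) G \<longleftrightarrow> (\<forall>k\<in>F. k + d \<in> G)"
    using int_image_subset_shift_iff[of F d G] by simp
  moreover have "bic_mult (i, i, F) (j, j, G) = (i, i, {k\<in>F. k + d \<in> G})"
    unfolding d bic_mult_ge by (simp add: add.commute)
  ultimately show ?thesis
    using True by auto
next
  case False
  \<comment> \<open>The product then carries the larger index \<open>j\<close> instead of \<open>i\<close>.\<close>
  then show ?thesis
    by simp
qed

theorem mainTheorem5:
  fixes \<F> :: "nat set set" and i j :: nat and F\<^sub>i F\<^sub>j :: "nat set"
  assumes "\<F> \<noteq> {}" and "omega_closed \<F>"
    and "F\<^sub>i \<in> \<F>" and "F\<^sub>i \<noteq> {}"
    and "F\<^sub>j \<in> \<F>" and "F\<^sub>j \<noteq> {}"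
  shows "idem_le (B_fam \<F>) (B_elem \<F> i i F\<^sub>i) (B_elem \<F> j j F\<^sub>j)
         \<longleftrightarrow> i \<ge> j \<and> int ` F\<^sub>i \<subseteq> shift (int j - int i) F\<^sub>j"
proof -
  have idem: "B_elem \<F> k k F \<in> idempotents (B_fam \<F>)" if "F \<in> \<F>" "F \<noteq> {}" for k F
  proof -
    have "bic_mult (k, k, F) (k, k, F) = (k, k, F)"
      using bic_mult_le[of k k F 0 k F] by simp
    then show ?thesis
      using that assms(2) by (simp add: idempotents_def B_elem_in_elems B_times_eq_iff del: bic_mult.simps)
  qed
  have "idem_le (B_fam \<F>) (B_elem \<F> i i F\<^sub>i) (B_elem \<F> j j F\<^sub>j)
      \<longleftrightarrow> bic_mult (i, i, F\<^sub>i) (j, j, F\<^sub>j) = (i, i, F\<^sub>i)"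
    using assms idem
    by (simp add: idem_le_def B_times_eq_iff bic_mult_diag_commute[of j F\<^sub>j] del: bic_mult.simps)
  then show ?thesis
    by (simp only: bic_mult_diag_absorb_iff)
qed

end
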